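(* Let $m\geq 3$ be an odd integer and let $\boldsymbol{E}_m\in\mathbb{R}^{m\times 2}$ be the matrix whose $j$-th row is $\left(\cos\frac{(j-1)\pi}{m},\ \sin\frac{(j-1)\pi}{m}\right)$, $j=1,\ldots,m$. Then $$\boldsymbol{E}_m\in \operatorname*{argmin}_{\boldsymbol{A}\in\mathbb{R}^{m\times 2}}\beta_{\boldsymbol{A}},$$ i.e., $\beta_{\boldsymbol{E}_m}=\min_{\boldsymbol{A}\in\mathbb{R}^{m\times 2}}\beta_{\boldsymbol{A}}$.
   Context: For $\boldsymbol{x},\boldsymbol{y}\in\mathbb{R}^d$ set $\mathrm{dist}(\boldsymbol{x},\boldsymbol{y}):=\min\{\|\boldsymbol{x}-\boldsymbol{y}\|_2,\|\boldsymbol{x}+\boldsymbol{y}\|_2\}$. For $\boldsymbol{A}\in\mathbb{R}^{m\times d}$, $|\boldsymbol{A}\boldsymbol{x}|\in\mathbb{R}_+^m$ denotes the vector of entrywise absolute values of $\boldsymbol{A}\boldsymbol{x}$. Define $$L_{\boldsymbol{A}}:=\inf_{\boldsymbol{x},\boldsymbol{y}\in\mathbb{R}^d,\ \mathrm{dist}(\boldsymbol{x},\boldsymbol{y})\neq 0}\frac{\||\boldsymbol{A}\boldsymbol{x}|-|\boldsymbol{A}\boldsymbol{y}|\|_2}{\mathrm{dist}(\boldsymbol{x},\boldsymbol{y})},\qquad U_{\boldsymbol{A}}:=\sup_{\boldsymbol{x},\boldsymbol{y}\in\mathbb{R}^d,\ \mathrm{dist}(\boldsymbol{x},\boldsymbol{y})\neq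 0}\frac{\||\boldsymbol{A}\boldsymbol{x}|-|\boldsymbol{A}\boldsymbol{y}|\|_2}{\mathrm{dist}(\boldsymbol{x},\boldsymbol{y})}.$$ The condition number is $\beta_{\boldsymbol{A}}:=U_{\boldsymbol{A}}/L_{\boldsymbol{A}}$, with the convention $\beta_{\boldsymbol{A}}=+\infty$ if $L_{\boldsymbol{A}}=0$. *)

theory Defs
  imports
    Complex_Main
    "HOL-Library.Extended_Real"
    "Jordan_Normal_Form.Matrix"
begin

definition norm2 :: "real vec \<Rightarrow> real" where
  "norm2 v = sqrt (v \<bullet> v)"

definition dist_pm :: "real vec \<Rightarrow> real vec \<Rightarrow> real" where
  "dist_pm x y = min (norm2 (x - y)) (norm2 (x + y))"

definition abs_vec :: "real vec \<Rightarrow> real vec" where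
  "abs_vec v = map_vec abs v"

definition distinct_pairs :: "nat \<Rightarrow> (real vec \<times> real vec) set" where
  "distinct_pairs d = {(x, y). x \<in> carrier_vec d \<and> y \<in> carrier_vec d \<and> dist_pm x y \<noteq> 0}"

definition stretch :: "real mat \<Rightarrow> real vec \<Rightarrow> real vec \<Rightarrow> real" where
  "stretch A x y = norm2 (abs_vec (A *\<^sub>v x) - abs_vec (A *\<^sub>v y)) / dist_pm x y"

text \<open>The infimum and the supremum are taken in the extended reals, so they need no
  boundedness or nonemptiness side conditions.\<close>

definition lower_lip :: "real mat \<Rightarrow> ereal" where
  "lower_lip A = (INF (x, y) \<in> distinct_pairs (dim_col A). ereal (stretch A x y))"

definition upper_lip :: "real mat \<Rightarrow> ereal" where
  "upper_lip A = (SUP (x, y) \<in> distinct_pairs (dim_col A). ereal (stretch A x y))"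

text \<open>The case distinction is needed because \<open>0 / 0 = 0\<close> in \<^typ>\<open>ereal\<close>, which would make the zero
  matrix a minimizer.\<close>

definition condition_number :: "real mat \<Rightarrow> ereal" where
  "condition_number A = (if lower_lip A = 0 then \<infinity> else upper_lip A / lower_lip A)"

text \<open>Rows are indexed from \<open>0\<close>, so row \<open>i\<close> here is the row with number \<open>j = i + 1\<close> in the usual
  numbering and its angle is \<open>(j - 1) * pi / m = i * pi / m\<close>.\<close>

definition harmonic_frame :: "nat \<Rightarrow> real mat" where
  "harmonic_frame m = mat m 2 (\<lambda>(i, k).
     if k = 0 then cos (real i * pi / real m) else sin (real i * pi / real m))"

end

theory Submission
  imports Defs "HOL-Analysis.Convex"
begin

text \<open>With \<open>a\<^sub>j\<close> the rows of \<open>A\<close>, the identity \<open>(\<bar>p\<bar> - \<bar>q\<bar>)\<^sup>2 = min ((p - q)\<^sup>2) ((p + q)\<^sup>2)\<close> turns the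
  squared stretch of \<open>(x, y)\<close> into the sum of \<open>min (\<langle>a\<^sub>j, x - y\<rangle>\<^sup>2) (\<langle>a\<^sub>j, x + y\<rangle>\<^sup>2)\<close> over the
  squared distance. Let \<open>r\<^sub>j\<close>, \<open>\<theta>\<^sub>j\<close> be the polar coordinates of \<open>a\<^sub>j\<close>, let \<open>W\<close> be the sum of the
  \<open>r\<^sub>j\<^sup>2\<close>, and \<open>s = sin (pi / (2 m))\<close>. Testing with coordinate vectors gives \<open>U\<^sup>2 \<ge> W / 2\<close>.
  Testing with orthonormal \<open>x - y\<close>, \<open>x + y\<close> at angle \<open>c / 2\<close> gives
  \<open>2 L\<^sup>2 \<le> W - f c\<close>, where \<open>f c = (\<Sum>j. r\<^sub>j\<^sup>2 \<bar>cos (2 \<theta>\<^sub>j - c)\<bar>)\<close>. The function \<open>f\<close> is half the width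
  of a zonogon with \<open>2 m\<close> edges, and a Reinhardt-type perimeter inequality says \<open>W \<le> m s M\<close>
  whenever \<open>f \<le> M\<close>; so that \<open>2 L\<^sup>2 \<le> W (1 - 1 / (m s))\<close>. For odd \<open>m\<close> the doubled angles of the
  harmonic frame are equally spaced modulo \<open>pi\<close>, so that all these bounds are attained.\<close>

section \<open>Sums of cosines\<close>

lemma abs_cos_add_int_pi: "\<bar>cos (x + of_int n * pi)\<bar> = \<bar>cos x\<bar>"
proof -
  have "sin (of_int n * pi) = 0" "\<bar>cos (of_int n * pi)\<bar> = 1"
    using sin_npi_int[of n] cos_npi_int[of n] by (simp_all add: mult.commute)
  then show ?thesis by (simp add: cos_add abs_mult)
qed

text \<open>Telescoping: multiplied by \<open>2 * sin d\<close>, each cosine becomes the difference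
  of the sines at distance \<open>d\<close> to either side.\<close>

lemma sum_cos_arithmetic_progression:
  "2 * sin d * (\<Sum>j<n. cos (x + 2 * d * real j)) = sin (x - d + 2 * d * real n) - sin (x - d)"
proof (induction n)
  case (Suc n)
  have "2 * sin d * cos (x + 2 * d * real n) = sin (x - d + 2 * d * real (Suc n)) - sin (x - d + 2 * d * real n)"
    using sin_add[of "x + 2 * d * real n" d] sin_diff[of "x + 2 * d * real n" d]
    by (simp add: algebra_simps)
  with Suc show ?case by (simp add: distrib_left)
qed simp

text \<open>Doubling is invertible modulo an odd number. This is where the oddness of
  \<open>m\<close> does its work.\<close>

lemma bij_betw_double_add_mod:
  fixes n :: int
  assumes "odd m"
  shows "bij_betw (\<lambda>j. nat ((2 * int j + n) mod int m)) {..<m} {..<m}"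
proof -
  have m: "m > 0" using assms by (cases m) auto
  have "inj_on (\<lambda>j. nat ((2 * int j + n) mod int m)) {..<m}"
  proof
    fix i j assume ij: "i \<in> {..<m}" "j \<in> {..<m}"
      and "nat ((2 * int i + n) mod int m) = nat ((2 * int j + n) mod int m)"
    then have "(2 * int i + n) mod int m = (2 * int j + n) mod int m"
      using m by (simp add: nat_eq_iff)
    then have "int m dvd 2 * (int i - int j)"
      by (simp add: mod_eq_dvd_iff algebra_simps)
    moreover have "coprime (int m) 2" using assms by simp
    ultimately have "int m dvd int i - int j"
      using coprime_dvd_mult_right_iff by blast
    then show "i = j" using ij
      by (metis lessThan_iff mod_eq_dvd_iff mod_less of_nat_eq_iff zmod_int)
  qed
  moreover have "(\<lambda>j. nat ((2 * int j + n) mod int m)) ` {..<m} \<subseteq> {..<m}"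
    using m by (auto simp: nat_less_iff)
  ultimately show ?thesis
    by (simp add: bij_betw_def endo_inj_surj)
qed

text \<open>Modulo pi and up to order, the angles have spacing pi / m because \<open>m\<close> is
  odd. Started near the left end of the half turn where cosine is nonnegative, they lose their
  absolute values and the sum telescopes.\<close>

lemma sum_abs_cos_le:
  assumes "odd m"
  shows "sin (pi / (2 * real m)) * (\<Sum>j<m. \<bar>cos (2 * pi * real j / real m + x)\<bar>) \<le> 1"
proof -
  have m: "m > 0" using assms by (cases m) auto
  \<comment> \<open>\<open>n\<close> counts the steps of length pi / m that bring \<open>x\<close>
    into the first step after - pi / 2.\<close>
  define n where "n = \<lfloor>(x + pi / 2) * real m / pi\<rfloor>"
  define y where "y = x - of_int n * pi / real m"
  define d where "d = pi / (2 * real m)"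
  define k where "k = (\<lambda>j. nat ((2 * int j + n) mod int m))"
  have "of_int n \<le> (x + pi / 2) * real m / pi" "(x + pi / 2) * real m / pi < of_int n + 1"
    unfolding n_def by linarith+
  then have "of_int n * pi \<le> (x + pi / 2) * real m" "(x + pi / 2) * real m < (of_int n + 1) * pi"
    by (simp_all only: pos_le_divide_eq[OF pi_gt_zero] pos_divide_less_eq[OF pi_gt_zero])
  then have "of_int n * pi / real m \<le> x + pi / 2" "x + pi / 2 < (of_int n + 1) * pi / real m"
    using m by (simp_all add: pos_divide_le_eq pos_less_divide_eq)
  then have y: "- (pi / 2) \<le> y" "y < - (pi / 2) + 2 * d"
    by (simp_all add: y_def d_def add_divide_distrib distrib_right)
  have k: "\<bar>cos (2 * pi * real j / real m + x)\<bar> = \<bar>cos (y + 2 * d * real (k j))\<bar>" for j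
  proof -
    define q where "q = (2 * int j + n) div int m"
    have "2 * int j + n = int (k j) + q * int m"
      using m by (simp add: k_def q_def)
    from arg_cong[OF this, of real_of_int] have "2 * real j = real (k j) + of_int q * real m - of_int n" by simp
    then have "pi * (2 * real j) / real m = pi * (real (k j) + of_int q * real m - of_int n) / real m" by simp
    then have "2 * pi * real j / real m + x = y + 2 * d * real (k j) + of_int q * pi"
      using m by (simp add: y_def d_def field_simps)
    then show ?thesis by (simp add: abs_cos_add_int_pi)
  qed
  have "(\<Sum>j<m. \<bar>cos (2 * pi * real j / real m + x)\<bar>) = (\<Sum>j<m. \<bar>cos (y + 2 * d * real (k j))\<bar>)"
    by (simp add: k)
  also have "\<dots> = (\<Sum>i<m. \<bar>cos (y + 2 * d * real i)\<bar>)"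
    using sum.reindex_bij_betw[OF bij_betw_double_add_mod[OF assms, of n],
        of "\<lambda>i. \<bar>cos (y + 2 * d * real i)\<bar>"] by (simp add: k_def)
  also have "\<dots> = (\<Sum>i<m. cos (y + 2 * d * real i))"
  proof (rule sum.cong)
    fix i assume "i \<in> {..<m}"
    \<comment> \<open>The last of the \<open>m\<close> angles is \<open>y + pi - 2 * d\<close>,
      still below pi / 2.\<close>
    then have "real i \<le> real m - 1" by simp
    then have "2 * d * real i \<le> 2 * d * (real m - 1)"
      by (intro mult_left_mono) (simp_all add: d_def)
    also have "\<dots> = pi - 2 * d" using m by (simp add: d_def field_simps)
    finally have "2 * d * real i \<le> pi - 2 * d" .
    moreover have "0 \<le> 2 * d * real i" by (simp add: d_def)
    ultimately have "cos (y + 2 * d * real i) \<ge> 0" using y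
      by (intro cos_ge_zero) linarith+
    then show "\<bar>cos (y + 2 * d * real i)\<bar> = cos (y + 2 * d * real i)" by simp
  qed simp
  finally have "2 * sin d * (\<Sum>j<m. \<bar>cos (2 * pi * real j / real m + x)\<bar>)
      = sin (y - d + 2 * d * real m) - sin (y - d)"
    by (simp only: sum_cos_arithmetic_progression)
  \<comment> \<open>The \<open>m\<close> steps make exactly half a turn, so the two sines are
    opposite.\<close>
  moreover have "2 * d * real m = pi" using m by (simp add: d_def)
  ultimately have "2 * sin d * (\<Sum>j<m. \<bar>cos (2 * pi * real j / real m + x)\<bar>) = - 2 * sin (y - d)"
    by simp
  also have "\<dots> \<le> 2" using sin_ge_minus_one[of "y - d"] by linarith
  finally show ?thesis by (simp add: d_def)
qed

text \<open>Here the progression makes a full turn, so the telescoped sum vanishes;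
  \<open>m \<ge> 2\<close> keeps \<open>sin (pi / m)\<close> nonzero.\<close>

lemma sum_cos_roots_of_unity:
  assumes "m \<ge> 2"
  shows "(\<Sum>j<m. cos (2 * pi * real j / real m + x)) = 0"
proof -
  have "2 * sin (pi / m) * (\<Sum>j<m. cos (x + 2 * (pi / m) * real j)) = sin (x - pi / m + 2 * pi) - sin (x - pi / m)"
    using assms by (subst sum_cos_arithmetic_progression) simp
  also have "\<dots> = 0" by (simp add: sin_add)
  finally have "2 * sin (pi / m) * (\<Sum>j<m. cos (x + 2 * (pi / m) * real j)) = 0" .
  moreover have "sin (pi / m) > 0"
    using assms by (intro sin_gt_zero) (simp_all add: field_simps)
  ultimately show ?thesis by (simp add: ac_simps)
qed

section \<open>The perimeter inequality for weighted angles\<close>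

lemma sum_sin_le:
  assumes "m > 0" and "\<And>k. k < m \<Longrightarrow> 0 \<le> g k" "\<And>k. k < m \<Longrightarrow> g k \<le> pi"
  shows "(\<Sum>k<m. sin (g k)) \<le> real m * sin ((\<Sum>k<m. g k) / real m)"
proof -
  have "concave_on {0..pi} sin"
    by (rule f''_le0_imp_concave[where f' = cos and f'' = "\<lambda>x. - sin x"])
      (auto intro!: derivative_eq_intros sin_ge_zero)
  then have "(\<Sum>k<m. (1 / real m) * sin (g k)) \<le> sin (\<Sum>k<m. (1 / real m) *\<^sub>R g k)"
    using assms by (intro concave_on_sum[where C = "{0..pi}"]) auto
  then show ?thesis using assms(1)
    by (simp add: sum_divide_distrib[symmetric] field_simps)
qed

text \<open>The directions \<open>c k\<close> normal to the bisectors of consecutive angles, weighted by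
  \<open>sin (g k)\<close> with \<open>g k\<close> half the gap, certify the bound: every single \<open>w j\<close> receives total
  weight at least 1, because \<open>cos (a k - a j)\<close> has total variation 2 over a half turn, and the
  weights sum to at most \<open>m sin (pi / (2 m))\<close> by concavity.\<close>

lemma sum_weights_le_sorted:
  assumes m: "m > 0" and w: "\<And>j. j < m \<Longrightarrow> 0 \<le> w j"
    and mono: "\<And>k. k < m \<Longrightarrow> a k \<le> a (Suc k)" and period: "a m = a 0 + pi"
    and bound: "\<And>c. (\<Sum>j<m. w j * \<bar>cos (a j - c)\<bar>) \<le> M"
  shows "(\<Sum>j<m. w j) \<le> M * (real m * sin (pi / (2 * real m)))"
proof -
  define g where "g = (\<lambda>k. (a (Suc k) - a k) / 2)"
  define c where "c = (\<lambda>k. (a (Suc k) + a k) / 2 + pi / 2)"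
  have sum_g: "(\<Sum>k<m. g k) = pi / 2"
    using period by (simp add: g_def sum_divide_distrib[symmetric] sum_lessThan_telescope)
  have g0: "0 \<le> g k" if "k < m" for k using mono[OF that] by (simp add: g_def)
  have g1: "g k \<le> pi" if "k < m" for k
    using member_le_sum[of k "{..<m}" g] g0 that sum_g pi_gt_zero by fastforce
  have sin_g: "0 \<le> sin (g k)" if "k < m" for k
    using g0 g1 that by (intro sin_ge_zero) auto
  have "0 \<le> (\<Sum>j<m. w j * \<bar>cos (a j - 0)\<bar>)"
    by (rule sum_nonneg) (simp add: w)
  then have M: "0 \<le> M" using bound[of 0] by linarith
  have ge1: "1 \<le> (\<Sum>k<m. sin (g k) * \<bar>cos (a j - c k)\<bar>)" if j: "j < m" for j
  proof -
    let ?h = "\<lambda>k. cos (a k - a j)"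
    have h: "2 * (sin (g k) * \<bar>cos (a j - c k)\<bar>) = \<bar>?h (Suc k) - ?h k\<bar>" if "k < m" for k
    proof -
      have "cos (a j - c k) = sin (a j - (a (Suc k) + a k) / 2)"
        unfolding c_def by (simp add: cos_diff cos_add sin_diff sin_add)
      also have "\<bar>\<dots>\<bar> = \<bar>sin ((a (Suc k) + a k) / 2 - a j)\<bar>"
        using sin_minus[of "(a (Suc k) + a k) / 2 - a j"] by simp
      finally have 1: "\<bar>cos (a j - c k)\<bar> = \<bar>sin ((a (Suc k) + a k) / 2 - a j)\<bar>" .
      have "?h k - ?h (Suc k) = 2 * sin ((a (Suc k) + a k) / 2 - a j) * sin (g k)"
        unfolding cos_diff_cos by (simp add: g_def field_simps)
      then have "\<bar>?h (Suc k) - ?h k\<bar> = 2 * \<bar>sin ((a (Suc k) + a k) / 2 - a j)\<bar> * sin (g k)"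
        using sin_g[OF that] by (simp add: abs_minus_commute abs_mult)
      with 1 show ?thesis by simp
    qed
    \<comment> \<open>With t = \<open>cos (a 0 - a j)\<close>, the values of \<open>?h\<close> at 0,
      \<open>j\<close> and \<open>m\<close> are t, 1 and - t. So the variation before and after
      \<open>j\<close> is at least 1 - t and 1 + t, together 2.\<close>
    have "(\<Sum>k=0..<j. ?h (Suc k) - ?h k) = 1 - cos (a 0 - a j)"
      by (subst sum_Suc_diff') simp_all
    moreover have "(\<Sum>k=j..<m. ?h (Suc k) - ?h k) = - cos (a 0 - a j) - 1"
      using j period by (subst sum_Suc_diff') (simp_all add: cos_diff cos_add sin_add)
    ultimately have "2 = \<bar>\<Sum>k=0..<j. ?h (Suc k) - ?h k\<bar> + \<bar>\<Sum>k=j..<m. ?h (Suc k) - ?h k\<bar>"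
      using cos_le_one[of "a 0 - a j"] cos_ge_minus_one[of "a 0 - a j"] by linarith
    also have "\<dots> \<le> (\<Sum>k=0..<j. \<bar>?h (Suc k) - ?h k\<bar>) + (\<Sum>k=j..<m. \<bar>?h (Suc k) - ?h k\<bar>)"
      by (intro add_mono sum_abs)
    also have "\<dots> = (\<Sum>k<m. \<bar>?h (Suc k) - ?h k\<bar>)"
      using j by (subst sum.atLeastLessThan_concat) (simp_all add: lessThan_atLeast0)
    also have "\<dots> = 2 * (\<Sum>k<m. sin (g k) * \<bar>cos (a j - c k)\<bar>)"
      unfolding sum_distrib_left by (intro sum.cong) (simp_all add: h)
    finally show ?thesis by simp
  qed
  \<comment> \<open>Double counting: after the exchange, each inner sum over \<open>j\<close> is the
    hypothesis \<open>bound\<close> in the direction \<open>c k\<close>.\<close>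
  have "(\<Sum>j<m. w j) \<le> (\<Sum>j<m. w j * (\<Sum>k<m. sin (g k) * \<bar>cos (a j - c k)\<bar>))"
    using mult_left_mono[OF ge1 w] by (intro sum_mono) simp
  also have "\<dots> = (\<Sum>k<m. sin (g k) * (\<Sum>j<m. w j * \<bar>cos (a j - c k)\<bar>))"
    unfolding sum_distrib_left by (subst sum.swap) (simp add: ac_simps)
  also have "\<dots> \<le> (\<Sum>k<m. sin (g k) * M)"
    by (intro sum_mono mult_left_mono bound sin_g) simp
  also have "\<dots> = M * (\<Sum>k<m. sin (g k))" by (simp add: sum_distrib_left mult.commute)
  also have "\<dots> \<le> M * (real m * sin ((\<Sum>k<m. g k) / real m))"
    using M m g0 g1 by (intro mult_left_mono sum_sin_le)
  finally show ?thesis by (simp add: sum_g)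
qed

text \<open>The absolute cosine has period pi and the sums ignore order, so the angles may be
  reduced to [0, pi) and sorted.\<close>

lemma sum_weights_le:
  assumes m: "m > 0" and w: "\<And>j. j < m \<Longrightarrow> 0 \<le> w j"
    and bound: "\<And>c. (\<Sum>j<m. w j * \<bar>cos (a j - c)\<bar>) \<le> M"
  shows "(\<Sum>j<m. w j) \<le> M * (real m * sin (pi / (2 * real m)))"
proof -
  define b where "b = (\<lambda>j. a j - of_int \<lfloor>a j / pi\<rfloor> * pi)"
  have b: "0 \<le> b j" "b j < pi" for j
  proof -
    have "of_int \<lfloor>a j / pi\<rfloor> \<le> a j / pi" "a j / pi < of_int \<lfloor>a j / pi\<rfloor> + 1" by linarith+
    then have "of_int \<lfloor>a j / pi\<rfloor> * pi \<le> a j" "a j < (of_int \<lfloor>a j / pi\<rfloor> + 1) * pi"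
      by (simp_all only: pos_le_divide_eq[OF pi_gt_zero] pos_divide_less_eq[OF pi_gt_zero])
    then show "0 \<le> b j" "b j < pi" by (simp_all add: b_def distrib_right)
  qed
  have cos_b: "\<bar>cos (b j - c)\<bar> = \<bar>cos (a j - c)\<bar>" for j c
    using abs_cos_add_int_pi[of "a j - c" "- \<lfloor>a j / pi\<rfloor>"] by (simp add: b_def algebra_simps)
  define xs where "xs = sort_key b [0..<m]"
  have xs: "length xs = m" "distinct xs" "set xs = {..<m}"
    by (simp_all add: xs_def lessThan_atLeast0)
  have bij: "bij_betw ((!) xs) {..<m} {..<m}"
    using xs by (intro bij_betw_nth) auto
  \<comment> \<open>The extra entry at index \<open>m\<close> repeats the smallest angle half a turn
    later and closes the cycle of gaps.\<close>
  define e where "e = (\<lambda>k. if k < m then b (xs ! k) else b (xs ! 0) + pi)"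
  have "(\<Sum>k<m. w (xs ! k)) \<le> M * (real m * sin (pi / (2 * real m)))"
  proof (rule sum_weights_le_sorted[where a = e])
    show "0 \<le> w (xs ! j)" if "j < m" for j
      using that w bij by (meson bij_betwE lessThan_iff)
    show "e k \<le> e (Suc k)" if "k < m" for k
    proof (cases "Suc k < m")
      case True
      have "sorted (map b xs)" by (simp add: xs_def)
      then have "map b xs ! k \<le> map b xs ! Suc k"
        using True xs(1) by (intro sorted_nth_mono) auto
      then show ?thesis using True xs(1) by (simp add: e_def)
    next
      case False
      have "b (xs ! k) \<le> b (xs ! 0) + pi"
        using b(2)[of "xs ! k"] b(1)[of "xs ! 0"] by linarith
      then show ?thesis using False that by (simp add: e_def)
    qed
    show "e m = e 0 + pi" using m by (simp add: e_def)
    show "(\<Sum>j<m. w (xs ! j) * \<bar>cos (e j - c)\<bar>) \<le> M" for c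
    proof -
      have "(\<Sum>j<m. w (xs ! j) * \<bar>cos (e j - c)\<bar>) = (\<Sum>j<m. w (xs ! j) * \<bar>cos (a (xs ! j) - c)\<bar>)"
        by (simp add: e_def cos_b)
      also have "\<dots> = (\<Sum>j<m. w j * \<bar>cos (a j - c)\<bar>)"
        by (rule sum.reindex_bij_betw[OF bij])
      finally show ?thesis using bound by simp
    qed
  qed (rule m)
  then show ?thesis by (simp add: sum.reindex_bij_betw[OF bij])
qed

section \<open>The stretch of a matrix with two columns\<close>

definition row_dot :: "real mat \<Rightarrow> nat \<Rightarrow> real vec \<Rightarrow> real" where
  "row_dot A j p = A $$ (j, 0) * p $ 0 + A $$ (j, 1) * p $ 1"

lemma norm2_eq_sqrt: "norm2 v = sqrt (\<Sum>i<dim_vec v. (v $ i)\<^sup>2)"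
  by (simp add: norm2_def scalar_prod_def power2_eq_square lessThan_atLeast0)

lemma norm2_carrier_vec_2: "p \<in> carrier_vec 2 \<Longrightarrow> norm2 p = sqrt ((p $ 0)\<^sup>2 + (p $ 1)\<^sup>2)"
  by (auto simp: norm2_eq_sqrt numeral_2_eq_2)

lemma norm2_nonneg: "0 \<le> norm2 v"
  by (simp add: norm2_eq_sqrt sum_nonneg)

lemma dist_pm_nonneg: "0 \<le> dist_pm x y"
  by (simp add: dist_pm_def norm2_nonneg)

lemma mult_mat_vec_index_2:
  assumes "A \<in> carrier_mat m 2" "x \<in> carrier_vec 2" "j < m"
  shows "(A *\<^sub>v x) $ j = row_dot A j x"
  using assms by (simp add: row_dot_def scalar_prod_def numeral_2_eq_2)

text \<open>The two squares differ by \<open>4 * a * b\<close>, so the sign of \<open>a * b\<close>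
  selects the smaller one.\<close>

lemma diff_abs_power2_eq_min: "(\<bar>a\<bar> - \<bar>b\<bar>)\<^sup>2 = min ((a - b)\<^sup>2) ((a + b)\<^sup>2)"
  for a b :: real
proof -
  have "(a - b)\<^sup>2 \<le> (a + b)\<^sup>2 \<longleftrightarrow> 0 \<le> a * b" by (simp add: power2_eq_square algebra_simps)
  then show ?thesis
    by (cases "0 \<le> a"; cases "0 \<le> b")
      (auto simp: min_def power2_eq_square algebra_simps zero_le_mult_iff)
qed

text \<open>Numerator and denominator depend only on \<open>x - y\<close> and \<open>x + y\<close>,
  so later arguments work with these two vectors.\<close>

lemma stretch_eq:
  assumes A: "A \<in> carrier_mat m 2" and x: "x \<in> carrier_vec 2" and y: "y \<in> carrier_vec 2"
  shows "stretch A x y =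
    sqrt (\<Sum>j<m. min ((row_dot A j (x - y))\<^sup>2) ((row_dot A j (x + y))\<^sup>2)) / dist_pm x y"
proof -
  have "(abs_vec (A *\<^sub>v x) - abs_vec (A *\<^sub>v y)) $ j = \<bar>row_dot A j x\<bar> - \<bar>row_dot A j y\<bar>"
    if "j < m" for j
    using that A mult_mat_vec_index_2[OF A x that] mult_mat_vec_index_2[OF A y that]
    by (simp add: abs_vec_def del: index_mult_mat_vec)
  moreover have "row_dot A j (x - y) = row_dot A j x - row_dot A j y"
    "row_dot A j (x + y) = row_dot A j x + row_dot A j y" for j
    using x y by (simp_all add: row_dot_def algebra_simps)
  moreover have "dim_vec (abs_vec (A *\<^sub>v x) - abs_vec (A *\<^sub>v y)) = m"
    using A by (simp add: abs_vec_def)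
  ultimately show ?thesis
    by (simp add: stretch_def norm2_eq_sqrt diff_abs_power2_eq_min)
qed

lemma stretch_nonneg: "0 \<le> stretch A x y"
  by (simp add: stretch_def dist_pm_nonneg norm2_nonneg)

section \<open>Bounds on both constants for an arbitrary matrix\<close>

lemma lower_lip_nonneg: "0 \<le> lower_lip A"
  unfolding lower_lip_def by (rule INF_greatest) (auto simp: stretch_nonneg)

text \<open>A unit vector paired with 0 is stretched by the norm of a column. The two squared column
  norms add up to the total, so one of them is at least half of it.\<close>

lemma upper_lip_ge:
  assumes A: "A \<in> carrier_mat m 2"
  shows "ereal (sqrt ((\<Sum>j<m. (A $$ (j, 0))\<^sup>2 + (A $$ (j, 1))\<^sup>2) / 2)) \<le> upper_lip A"
proof -
  have col: "ereal (sqrt (\<Sum>j<m. (A $$ (j, k))\<^sup>2)) \<le> upper_lip A" if k: "k = 0 \<or> k = 1" for k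
  proof -
    let ?e = "unit_vec 2 k :: real vec"
    have d: "dist_pm ?e (0\<^sub>v 2) = 1"
      using k by (auto simp: dist_pm_def norm2_carrier_vec_2)
    then have "(?e, 0\<^sub>v 2) \<in> distinct_pairs (dim_col A)"
      using A by (simp add: distinct_pairs_def)
    moreover have "stretch A ?e (0\<^sub>v 2) = sqrt (\<Sum>j<m. (A $$ (j, k))\<^sup>2)"
      using d k by (subst stretch_eq[OF A]) (auto simp: row_dot_def)
    ultimately show ?thesis
      unfolding upper_lip_def by (intro SUP_upper2) auto
  qed
  let ?S = "\<lambda>k. \<Sum>j<m. (A $$ (j, k))\<^sup>2"
  have "(\<Sum>j<m. (A $$ (j, 0))\<^sup>2 + (A $$ (j, 1))\<^sup>2) = ?S 0 + ?S 1" by (rule sum.distrib)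
  then have "(\<Sum>j<m. (A $$ (j, 0))\<^sup>2 + (A $$ (j, 1))\<^sup>2) / 2 \<le> ?S 0
      \<or> (\<Sum>j<m. (A $$ (j, 0))\<^sup>2 + (A $$ (j, 1))\<^sup>2) / 2 \<le> ?S 1" by linarith
  then show ?thesis
  proof
    assume "(\<Sum>j<m. (A $$ (j, 0))\<^sup>2 + (A $$ (j, 1))\<^sup>2) / 2 \<le> ?S 0"
    then show ?thesis
      by (intro order_trans[OF _ col[of 0]]) (simp_all only: ereal_less_eq real_sqrt_le_iff simp_thms)
  next
    assume "(\<Sum>j<m. (A $$ (j, 0))\<^sup>2 + (A $$ (j, 1))\<^sup>2) / 2 \<le> ?S 1"
    then show ?thesis
      by (intro order_trans[OF _ col[of 1]]) (simp_all only: ereal_less_eq real_sqrt_le_iff simp_thms)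
  qed
qed

text \<open>For an orthonormal pair turned by \<open>c / 2\<close>, row \<open>j\<close> contributes
  \<open>(r j)\<^sup>2\<close> times the smaller of the squared sine and cosine of t =
  \<open>\<theta> j - c / 2\<close>, which is (1 - |cos 2t|) / 2.\<close>

lemma lower_lip_le:
  assumes A: "A \<in> carrier_mat m 2"
    and polar: "\<And>j. A $$ (j, 0) = r j * cos (\<theta> j)" "\<And>j. A $$ (j, 1) = r j * sin (\<theta> j)"
  shows "lower_lip A \<le>
    ereal (sqrt (((\<Sum>j<m. (r j)\<^sup>2) - (\<Sum>j<m. (r j)\<^sup>2 * \<bar>cos (2 * \<theta> j - c)\<bar>)) / 2))"
proof -
  define u where "u = vec 2 (\<lambda>i. if i = 0 then cos (c / 2) else sin (c / 2))"
  define v where "v = vec 2 (\<lambda>i. if i = 0 then - sin (c / 2) else cos (c / 2))"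
  \<comment> \<open>Chosen so that \<open>x + y\<close> and \<open>x - y\<close> are the unit
    vectors \<open>u\<close> and \<open>v\<close>; hence the distance is 1.\<close>
  define x where "x = (1 / 2) \<cdot>\<^sub>v (u + v)"
  define y where "y = (1 / 2) \<cdot>\<^sub>v (u - v)"
  have car: "u \<in> carrier_vec 2" "v \<in> carrier_vec 2" "x \<in> carrier_vec 2" "y \<in> carrier_vec 2"
    by (simp_all add: u_def v_def x_def y_def)
  have xy: "x - y = v" "x + y = u"
    by (auto simp: x_def y_def u_def v_def field_simps)
  have "norm2 u = 1" "norm2 v = 1"
    unfolding norm2_carrier_vec_2[OF car(1)] norm2_carrier_vec_2[OF car(2)]
    by (simp_all add: u_def v_def)
  then have d: "dist_pm x y = 1" by (simp add: dist_pm_def xy)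
  have min_eq: "min ((row_dot A j v)\<^sup>2) ((row_dot A j u)\<^sup>2) = ((r j)\<^sup>2 - (r j)\<^sup>2 * \<bar>cos (2 * \<theta> j - c)\<bar>) / 2" for j
  proof -
    let ?t = "\<theta> j - c / 2"
    have "row_dot A j u = r j * cos ?t" "row_dot A j v = r j * sin ?t"
      by (simp_all add: row_dot_def polar u_def v_def cos_diff sin_diff algebra_simps del: One_nat_def)
    then have "(row_dot A j u)\<^sup>2 = (r j)\<^sup>2 * (cos ?t)\<^sup>2" "(row_dot A j v)\<^sup>2 = (r j)\<^sup>2 * (sin ?t)\<^sup>2"
      by (simp_all add: power_mult_distrib)
    moreover have "(cos ?t)\<^sup>2 = (1 + cos (2 * \<theta> j - c)) / 2" "(sin ?t)\<^sup>2 = (1 - cos (2 * \<theta> j - c)) / 2"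
      using cos_double_cos[of ?t] cos_double_sin[of ?t] by (simp_all add: algebra_simps)
    ultimately have "min ((row_dot A j v)\<^sup>2) ((row_dot A j u)\<^sup>2)
        = (r j)\<^sup>2 * min ((1 - cos (2 * \<theta> j - c)) / 2) ((1 + cos (2 * \<theta> j - c)) / 2)"
      by (simp add: min_mult_distrib_left)
    also have "min ((1 - z) / 2) ((1 + z) / 2) = (1 - \<bar>z\<bar>) / 2" for z :: real
      by (simp add: min_def abs_if)
    finally show ?thesis by (simp add: right_diff_distrib)
  qed
  have "stretch A x y = sqrt (((\<Sum>j<m. (r j)\<^sup>2) - (\<Sum>j<m. (r j)\<^sup>2 * \<bar>cos (2 * \<theta> j - c)\<bar>)) / 2)"
    unfolding stretch_eq[OF A car(3,4)] xy d min_eq by (simp only: sum_subtractf sum_divide_distrib[symmetric] div_by_1)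
  moreover have "(x, y) \<in> distinct_pairs (dim_col A)"
    using A car d by (simp add: distinct_pairs_def)
  ultimately show ?thesis
    unfolding lower_lip_def by (intro INF_lower2) auto
qed

section \<open>The harmonic frame\<close>

lemma harmonic_frame_carrier: "harmonic_frame m \<in> carrier_mat m 2"
  by (simp add: harmonic_frame_def)

text \<open>Squaring doubles the angle between row and \<open>p\<close>, so the row angles become
  those of the \<open>m\<close>-th roots of unity. The phase is minus twice the polar angle of
  \<open>p\<close>.\<close>

lemma harmonic_frame_row_dot:
  assumes "p \<in> carrier_vec 2"
  shows "\<exists>\<psi>. \<forall>j<m. (row_dot (harmonic_frame m) j p)\<^sup>2
    = (norm2 p)\<^sup>2 * ((1 + cos (2 * pi * real j / real m + \<psi>)) / 2)"
proof -
  obtain r \<phi> where p: "p $ 0 = r * cos \<phi>" "p $ 1 = r * sin \<phi>" using polar_Ex by blast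
  have "(p $ 0)\<^sup>2 + (p $ 1)\<^sup>2 = r\<^sup>2"
    unfolding p power_mult_distrib by (simp flip: distrib_left)
  then have n: "(norm2 p)\<^sup>2 = r\<^sup>2" by (simp add: norm2_carrier_vec_2[OF assms] del: One_nat_def)
  have "(row_dot (harmonic_frame m) j p)\<^sup>2
      = (norm2 p)\<^sup>2 * ((1 + cos (2 * pi * real j / real m + (- 2 * \<phi>))) / 2)" if "j < m" for j
  proof -
    let ?t = "real j * pi / real m - \<phi>"
    have "row_dot (harmonic_frame m) j p = r * cos ?t"
      using that by (simp add: row_dot_def harmonic_frame_def p cos_diff algebra_simps del: One_nat_def)
    moreover have "2 * ?t = 2 * pi * real j / real m + (- 2 * \<phi>)" by (simp add: algebra_simps)
    then have "cos (2 * pi * real j / real m + (- 2 * \<phi>)) = 2 * (cos ?t)\<^sup>2 - 1"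
      by (metis cos_double_cos)
    ultimately show ?thesis by (simp add: n power_mult_distrib)
  qed
  then show ?thesis by blast
qed

text \<open>The frame is tight: the cosines cancel, so the squared row products sum to
  \<open>m / 2\<close> times the squared norm. The sum of minima is at most this value for the
  shorter of \<open>x - y\<close> and \<open>x + y\<close>.\<close>

lemma stretch_harmonic_frame_le:
  assumes m: "m \<ge> 2" and x: "x \<in> carrier_vec 2" and y: "y \<in> carrier_vec 2"
  shows "stretch (harmonic_frame m) x y \<le> sqrt (real m / 2)"
proof -
  have tight: "(\<Sum>j<m. (row_dot (harmonic_frame m) j p)\<^sup>2) = real m / 2 * (norm2 p)\<^sup>2"
    if "p \<in> carrier_vec 2" for p
  proof -
    obtain \<psi> where "\<And>j. j < m \<Longrightarrow> (row_dot (harmonic_frame m) j p)\<^sup>2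
        = (norm2 p)\<^sup>2 * ((1 + cos (2 * pi * real j / real m + \<psi>)) / 2)"
      using harmonic_frame_row_dot[OF \<open>p \<in> carrier_vec 2\<close>, of m] by blast
    then have "(\<Sum>j<m. (row_dot (harmonic_frame m) j p)\<^sup>2)
        = (norm2 p)\<^sup>2 * ((\<Sum>j<m. 1 + cos (2 * pi * real j / real m + \<psi>)) / 2)"
      unfolding sum_distrib_left sum_divide_distrib by (intro sum.cong) simp_all
    then show ?thesis by (simp add: sum.distrib sum_cos_roots_of_unity[OF m])
  qed
  let ?S = "\<Sum>j<m. min ((row_dot (harmonic_frame m) j (x - y))\<^sup>2) ((row_dot (harmonic_frame m) j (x + y))\<^sup>2)"
  have "?S \<le> (\<Sum>j<m. (row_dot (harmonic_frame m) j (x - y))\<^sup>2)"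
    "?S \<le> (\<Sum>j<m. (row_dot (harmonic_frame m) j (x + y))\<^sup>2)"
    by (auto intro: sum_mono)
  then have "?S \<le> real m / 2 * (norm2 (x - y))\<^sup>2" "?S \<le> real m / 2 * (norm2 (x + y))\<^sup>2"
    using x y by (simp_all only: tight minus_carrier_vec add_carrier_vec)
  then have "?S \<le> real m / 2 * (dist_pm x y)\<^sup>2"
    by (simp add: dist_pm_def min_def)
  then have "sqrt ?S \<le> sqrt (real m / 2 * (dist_pm x y)\<^sup>2)" by (rule real_sqrt_le_mono)
  then have le: "sqrt ?S \<le> sqrt (real m / 2) * dist_pm x y"
    by (simp only: real_sqrt_mult real_sqrt_abs abs_of_nonneg[OF dist_pm_nonneg])
  show ?thesis
  proof (cases "dist_pm x y = 0")
    \<comment> \<open>Division by zero makes the stretch 0 here.\<close>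
    case True
    then show ?thesis by (simp add: stretch_def)
  next
    case False
    then have "0 < dist_pm x y" using dist_pm_nonneg[of x y] by simp
    then show ?thesis
      unfolding stretch_eq[OF harmonic_frame_carrier x y] using le by (simp only: pos_divide_le_eq)
  qed
qed

text \<open>A minimum is the mean minus half the distance. The means sum to a constant since the
  cosines cancel, and the distances are controlled by \<open>sum_abs_cos_le\<close>.\<close>

lemma sum_min_shifted_roots_ge:
  assumes "m \<ge> 2" "odd m"
  shows "(real m - 1 / sin (pi / (2 * real m))) / 2 \<le>
    (\<Sum>j<m. min ((1 + cos (2 * pi * real j / real m + \<psi>)) / 2) ((1 + cos (2 * pi * real j / real m + \<chi>)) / 2))"
proof -
  let ?t = "\<lambda>j. 2 * pi * real j / real m"
  \<comment> \<open>The shift by pi / 2 writes the sine from the product formula as a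
    cosine.\<close>
  let ?T = "\<Sum>j<m. \<bar>cos (?t j + ((\<psi> + \<chi>) / 2 - pi / 2))\<bar>"
  have "sin (pi / (2 * real m)) > 0"
    using assms by (intro sin_gt_zero) (simp_all add: field_simps)
  then have T: "?T \<le> 1 / sin (pi / (2 * real m))"
    using sum_abs_cos_le[OF assms(2), of "(\<psi> + \<chi>) / 2 - pi / 2"] by (simp add: field_simps)
  have "(1 + (cos (?t j + \<psi>) + cos (?t j + \<chi>)) / 2 - \<bar>cos (?t j + ((\<psi> + \<chi>) / 2 - pi / 2))\<bar>) / 2
      \<le> min ((1 + cos (?t j + \<psi>)) / 2) ((1 + cos (?t j + \<chi>)) / 2)" for j
  proof -
    have "(?t j + \<psi> + (?t j + \<chi>)) / 2 = ?t j + (\<psi> + \<chi>) / 2" by simp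
    then have "cos (?t j + \<psi>) - cos (?t j + \<chi>)
        = 2 * sin (?t j + (\<psi> + \<chi>) / 2) * sin ((?t j + \<chi> - (?t j + \<psi>)) / 2)"
      by (simp only: cos_diff_cos)
    also have "sin (?t j + (\<psi> + \<chi>) / 2) = cos (?t j + ((\<psi> + \<chi>) / 2 - pi / 2))"
      by (simp add: cos_diff cos_add sin_add sin_diff)
    \<comment> \<open>The sine of half the phase difference is bounded by 1, with equality in
      absolute value for phases differing by pi, which correspond to orthogonal directions.\<close>
    finally have "\<bar>cos (?t j + \<psi>) - cos (?t j + \<chi>)\<bar> \<le> 2 * \<bar>cos (?t j + ((\<psi> + \<chi>) / 2 - pi / 2))\<bar>"
      by (simp add: abs_mult mult_left_le)
    then show ?thesis by (simp add: min_def abs_if field_simps split: if_splits)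
  qed
  then have "(\<Sum>j<m. (1 + (cos (?t j + \<psi>) + cos (?t j + \<chi>)) / 2 - \<bar>cos (?t j + ((\<psi> + \<chi>) / 2 - pi / 2))\<bar>) / 2)
      \<le> (\<Sum>j<m. min ((1 + cos (?t j + \<psi>)) / 2) ((1 + cos (?t j + \<chi>)) / 2))"
    by (rule sum_mono)
  moreover have "(\<Sum>j<m. (1 + (cos (?t j + \<psi>) + cos (?t j + \<chi>)) / 2 - \<bar>cos (?t j + ((\<psi> + \<chi>) / 2 - pi / 2))\<bar>) / 2)
      = (real m - ?T) / 2"
    using sum_cos_roots_of_unity[OF assms(1), of \<psi>] sum_cos_roots_of_unity[OF assms(1), of \<chi>]
    by (simp only: sum_divide_distrib[symmetric] sum.distrib sum_subtractf) simp
  ultimately show ?thesis using T divide_right_mono[of "real m - 1 / sin (pi / (2 * real m))" "real m - ?T" 2] by simp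
qed

text \<open>Replacing the norms of \<open>x - y\<close> and \<open>x + y\<close> by the smaller one,
  \<open>dist_pm x y\<close>, only lowers the minima and reduces the claim to unit length.\<close>

lemma stretch_harmonic_frame_ge:
  assumes m: "m \<ge> 2" "odd m" and x: "x \<in> carrier_vec 2" and y: "y \<in> carrier_vec 2"
    and d: "dist_pm x y \<noteq> 0"
  shows "sqrt ((real m - 1 / sin (pi / (2 * real m))) / 2) \<le> stretch (harmonic_frame m) x y"
proof -
  let ?E = "harmonic_frame m"
  let ?c = "(real m - 1 / sin (pi / (2 * real m))) / 2"
  have pos: "0 < dist_pm x y"
    using d dist_pm_nonneg[of x y] by simp
  obtain \<psi> where \<psi>: "\<And>j. j < m \<Longrightarrow> (row_dot ?E j (x - y))\<^sup>2
      = (norm2 (x - y))\<^sup>2 * ((1 + cos (2 * pi * real j / real m + \<psi>)) / 2)"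
    using harmonic_frame_row_dot[of "x - y" m] x y by auto
  obtain \<chi> where \<chi>: "\<And>j. j < m \<Longrightarrow> (row_dot ?E j (x + y))\<^sup>2
      = (norm2 (x + y))\<^sup>2 * ((1 + cos (2 * pi * real j / real m + \<chi>)) / 2)"
    using harmonic_frame_row_dot[of "x + y" m] x y by auto
  have le: "(dist_pm x y)\<^sup>2 \<le> (norm2 (x - y))\<^sup>2" "(dist_pm x y)\<^sup>2 \<le> (norm2 (x + y))\<^sup>2"
    using pos by (simp_all add: dist_pm_def power_mono)
  have nn: "0 \<le> (1 + cos z) / 2" for z :: real
    using cos_ge_minus_one[of z] by (simp del: cos_ge_minus_one)
  have "(dist_pm x y)\<^sup>2 * ?c \<le> (dist_pm x y)\<^sup>2 * (\<Sum>j<m.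
      min ((1 + cos (2 * pi * real j / real m + \<psi>)) / 2) ((1 + cos (2 * pi * real j / real m + \<chi>)) / 2))"
    by (intro mult_left_mono sum_min_shifted_roots_ge m) simp
  also have "\<dots> \<le> (\<Sum>j<m. min ((row_dot ?E j (x - y))\<^sup>2) ((row_dot ?E j (x + y))\<^sup>2))"
    unfolding sum_distrib_left
  proof (rule sum_mono)
    fix j assume "j \<in> {..<m}"
    then have j: "j < m" by simp
    show "(dist_pm x y)\<^sup>2 * min ((1 + cos (2 * pi * real j / real m + \<psi>)) / 2) ((1 + cos (2 * pi * real j / real m + \<chi>)) / 2)
      \<le> min ((row_dot ?E j (x - y))\<^sup>2) ((row_dot ?E j (x + y))\<^sup>2)"
      unfolding \<psi>[OF j] \<chi>[OF j] 
      by (intro min.boundedI mult_mono le min.cobounded1 min.cobounded2 zero_le_power2 nn)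
  qed
  finally have "sqrt ((dist_pm x y)\<^sup>2 * ?c)
      \<le> sqrt (\<Sum>j<m. min ((row_dot ?E j (x - y))\<^sup>2) ((row_dot ?E j (x + y))\<^sup>2))"
    by (rule real_sqrt_le_mono)
  then have "dist_pm x y * sqrt ?c \<le> sqrt (\<Sum>j<m. min ((row_dot ?E j (x - y))\<^sup>2) ((row_dot ?E j (x + y))\<^sup>2))"
    using pos by (simp only: real_sqrt_mult real_sqrt_abs abs_of_pos)
  then show ?thesis
    unfolding stretch_eq[OF harmonic_frame_carrier x y] using pos
    by (simp only: pos_le_divide_eq mult.commute)
qed

text \<open>The hypothesis \<open>s\<close> makes the lower stretch bound positive, so the condition
  number is a genuine quotient, at most the ratio of the two stretch bounds.\<close>

lemma condition_number_harmonic_frame_le: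
  assumes m: "m \<ge> 2" "odd m" and s: "1 < real m * sin (pi / (2 * real m))"
  shows "condition_number (harmonic_frame m) \<le>
    ereal (sqrt (real m / 2) / sqrt ((real m - 1 / sin (pi / (2 * real m))) / 2))"
proof -
  let ?E = "harmonic_frame m" and ?l = "sqrt ((real m - 1 / sin (pi / (2 * real m))) / 2)"
  have col: "dim_col ?E = 2" by (simp add: harmonic_frame_def)
  have "sin (pi / (2 * real m)) > 0"
    using m by (intro sin_gt_zero) (simp_all add: field_simps)
  then have l: "0 < ?l" using s m by (simp add: field_simps)
  have lower: "ereal ?l \<le> lower_lip ?E"
    unfolding lower_lip_def col
    by (rule INF_greatest) (auto simp: distinct_pairs_def stretch_harmonic_frame_ge[OF m])
  have pos: "0 < lower_lip ?E" using l lower by (meson ereal_less(2) less_le_trans)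
  have "upper_lip ?E \<le> ereal (sqrt (real m / 2))"
    unfolding upper_lip_def col
    by (rule SUP_least) (auto simp: distinct_pairs_def stretch_harmonic_frame_le[OF m(1)])
  then have "upper_lip ?E / lower_lip ?E \<le> ereal (sqrt (real m / 2)) / lower_lip ?E"
    by (rule ereal_divide_right_mono) (use pos in simp)
  also have "\<dots> \<le> ereal (sqrt (real m / 2)) / ereal ?l"
    using m lower by (intro ereal_divide_left_mono) (use l pos in \<open>simp_all only: ereal_zero_less_0_iff ereal_less simp_thms real_sqrt_ge_0_iff\<close>, simp)
  also have "\<dots> = ereal (sqrt (real m / 2) / ?l)" using l by simp
  finally have "upper_lip ?E / lower_lip ?E \<le> ereal (sqrt (real m / 2) / ?l)" .
  moreover have "lower_lip ?E \<noteq> 0" using pos by simp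
  ultimately show ?thesis by (simp only: condition_number_def if_False)
qed

section \<open>Comparison with an arbitrary matrix\<close>

theorem theorem3p1:
  fixes m :: nat
  assumes "m \<ge> 3" and "odd m"
  shows "is_arg_min condition_number (\<lambda>A. A \<in> carrier_mat m 2) (harmonic_frame m)"
proof -
  define s where "s = sin (pi / (2 * real m))"
  have s: "0 < s" unfolding s_def
    using assms by (intro sin_gt_zero) (simp_all add: field_simps)
  have "condition_number (harmonic_frame m) \<le> condition_number A" if A: "A \<in> carrier_mat m 2" for A
  proof (cases "lower_lip A = 0")
    case True
    then show ?thesis by (simp add: condition_number_def)
  next
    case False
    \<comment> \<open>Any two reals have polar coordinates, so the unspecified entries with
      \<open>j \<ge> m\<close> are covered too.\<close>
    have "\<forall>j. \<exists>r t. A $$ (j, 0) = r * cos t \<and> A $$ (j, 1) = r * sin t"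
      using polar_Ex by blast
    then obtain r \<theta> where polar: "\<And>j. A $$ (j, 0) = r j * cos (\<theta> j)" "\<And>j. A $$ (j, 1) = r j * sin (\<theta> j)"
      by metis
    define W where "W = (\<Sum>j<m. (r j)\<^sup>2)"
    have W: "0 \<le> W" by (simp add: W_def sum_nonneg)
    note low = lower_lip_le[OF A polar, folded W_def]
    obtain l where l: "lower_lip A = ereal l"
      using low[of 0] lower_lip_nonneg[of A] by (cases "lower_lip A") auto
    then have l0: "0 < l" using False lower_lip_nonneg[of A] by simp
    \<comment> \<open>The lower bound on every test pair becomes a bound uniform in
      \<open>c\<close>: the \<open>M\<close> of \<open>sum_weights_le\<close> for the doubled
      angles.\<close>
    have "(\<Sum>j<m. (r j)\<^sup>2 * \<bar>cos (2 * \<theta> j - c)\<bar>) \<le> W - 2 * l\<^sup>2" for c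
    proof -
      have "l \<le> sqrt ((W - (\<Sum>j<m. (r j)\<^sup>2 * \<bar>cos (2 * \<theta> j - c)\<bar>)) / 2)"
        using low[of c] l by simp
      moreover from this have "0 < (W - (\<Sum>j<m. (r j)\<^sup>2 * \<bar>cos (2 * \<theta> j - c)\<bar>)) / 2"
        using l0 by (meson less_le_trans real_sqrt_gt_0_iff)
      ultimately have "l\<^sup>2 \<le> (W - (\<Sum>j<m. (r j)\<^sup>2 * \<bar>cos (2 * \<theta> j - c)\<bar>)) / 2"
        using power_mono[of l _ 2] l0 by (fastforce simp del: real_sqrt_le_iff)
      then show ?thesis by simp
    qed
    then have core: "W \<le> (W - 2 * l\<^sup>2) * (real m * s)"
      unfolding W_def s_def using assms by (intro sum_weights_le) auto
    have ms0: "0 < real m * s" using s assms by simp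
    have key: "2 * l\<^sup>2 * (real m * s) \<le> W * (real m * s - 1)"
      using core by (simp add: algebra_simps)
    moreover have "0 < 2 * l\<^sup>2 * (real m * s)" using l0 ms0 by (simp only: zero_less_mult_iff) simp
    \<comment> \<open>A matrix with \<open>l > 0\<close> itself forces this, since
      \<open>key\<close> has a positive left side and \<open>W\<close> is nonnegative.\<close>
    ultimately have ms: "1 < real m * s"
      using W by (smt (verit) mult_nonneg_nonpos)
    have "sqrt (real m / 2) / sqrt ((real m - 1 / s) / 2) \<le> sqrt (W / 2) / l"
    proof -
      have pos: "0 < (real m - 1 / s) / 2" using ms s by (simp add: field_simps)
      \<comment> \<open>The squared claim with denominators cleared by \<open>4 * s\<close> is
        exactly \<open>key\<close>.\<close>
      have "(l\<^sup>2 * (real m / 2)) * (4 * s) \<le> (W / 2 * ((real m - 1 / s) / 2)) * (4 * s)"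
      proof -
        have "(l\<^sup>2 * (real m / 2)) * (4 * s) = 2 * l\<^sup>2 * (real m * s)" by simp
        moreover have "(W / 2 * ((real m - 1 / s) / 2)) * (4 * s) = W * (real m * s - 1)"
          using s by (simp add: right_diff_distrib left_diff_distrib)
        ultimately show ?thesis using key by (simp only:)
      qed
      then have "l\<^sup>2 * (real m / 2) \<le> W / 2 * ((real m - 1 / s) / 2)"
        using s by simp
      then have "sqrt (l\<^sup>2 * (real m / 2)) \<le> sqrt (W / 2 * ((real m - 1 / s) / 2))"
        by (rule real_sqrt_le_mono)
      then have "l * sqrt (real m / 2) \<le> sqrt (W / 2) * sqrt ((real m - 1 / s) / 2)"
        using l0 by (simp only: real_sqrt_mult real_sqrt_abs abs_of_pos)
      moreover have "0 < sqrt ((real m - 1 / s) / 2)" using pos by (rule real_sqrt_gt_zero)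
      ultimately show ?thesis
        using l0 by (simp only: pos_divide_le_eq pos_le_divide_eq times_divide_eq_left times_divide_eq_right mult.commute)
    qed
    then have "condition_number (harmonic_frame m) \<le> ereal (sqrt (W / 2) / l)"
      using assms ms
      unfolding s_def by (intro order_trans[OF condition_number_harmonic_frame_le[of m]]) simp_all
    also have "\<dots> = ereal (sqrt (W / 2)) / lower_lip A" using l l0 by simp
    also have "\<dots> \<le> upper_lip A / lower_lip A"
    proof (rule ereal_divide_right_mono)
      have "(\<Sum>j<m. (A $$ (j, 0))\<^sup>2 + (A $$ (j, 1))\<^sup>2) = W"
        unfolding W_def polar power_mult_distrib by (simp add: distrib_left[symmetric])
      then show "ereal (sqrt (W / 2)) \<le> upper_lip A" using upper_lip_ge[OF A] by simp
    qed (use l l0 in simp)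
    also have "\<dots> = condition_number A" using False by (simp add: condition_number_def)
    finally show ?thesis .
  qed
  then show ?thesis
    using harmonic_frame_carrier by (auto simp: is_arg_min_def not_less)
qed

end
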